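(* Let $I\subseteq\mathbb{R}[X_1,\ldots,X_n]$ be any ideal such that its real variety $\mathcal{V}_{\mathbb{R}}(I)$ has a convex-singular point. Then for all $d$ the theta body $\mathrm{TH}(I)_d$ strictly contains $\overline{\operatorname{conv}(\mathcal{V}_{\mathbb{R}}(I))}$.
   Context: Write $\underline X=(X_1,\ldots,X_n)$. For an ideal $I\subseteq\mathbb{R}[\underline X]$, let $\mathcal{V}_{\mathbb{R}}(I)=\{x\in\mathbb{R}^n\mid g(x)=0\text{ for all }g\in I\}$. Let $\Sigma(d,I)$ be the set of all polynomials $p$ such that $p-\sigma\in I$ for some sum of squares of polynomials $\sigma$ with $\deg(\sigma)\le 2d$. The $d$-th theta body $\mathrm{TH}(I)_d$ is the intersection of all half-spaces $\{x\in\mathbb{R}^n\mid\ell(x)\ge 0\}$, where $\ell$ ranges over all (affine) linear polynomials, i.e. polynomials of degree at most $1$, in $\Sigma(d,I)$. For $p\in\mathcal{V}_{\mathbb{R}}(I)$, the tangent space $T_p(I)$ is the affine space through $p$ that is orthogonal to the space spanned by the gradients at $p$ of all polynomials in the vanishing ideal of $\mathcal{V}_{\mathbb{R}}(I)$. A point $p\in\mathcal{V}_{\mathbb{R}}(I)$ on the boundary of $\operatorname{conv}(\mathcal{V}_{\mathbb{R}}(I))$ is called convex-non-singular if $T_p(I)$ is tangent to $\operatorname{conv}(\mathcal{V}_{\mathbb{R}}(I))$, i.e. if $T_p(I)$ does not intersect the relative interior of $\operatorname{conv}(\mathcal{V}_{\mathbb{R}}(I))$; otherwise $p$ is called convex-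singular.
   Formalization: "Boundary" of the convex hull is read as relative boundary; with the topological boundary the claim fails, e.g. for I=(X_2) in R[X_1,X_2], where every point of the line would be convex-singular although the theta bodies equal the line. *)

theory Defs
  imports "HOL-Analysis.Analysis" "HOL-Library.Poly_Mapping"
begin

text \<open>
  The polynomial ring in the variables indexed by the finite type \<open>'n\<close>: finitely supported maps
  from monomials (exponent vectors) to coefficients. Sum and (convolution) product are those of
  the ring instance in the theory of polynomial mappings.
\<close>
type_synonym 'n mpoly = "('n \<Rightarrow>\<^sub>0 nat) \<Rightarrow>\<^sub>0 real"

definition eval_mpoly :: "'n::finite mpoly \<Rightarrow> real^'n \<Rightarrow> real" where
  "eval_mpoly f x =
     (\<Sum>m\<in>Poly_Mapping.keys f. Poly_Mapping.lookup f m * (\<Prod>i\<in>UNIV. (x $ i) ^ Poly_Mapping.lookup m i))"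

text \<open>Total degree; the zero polynomial is given degree 0, so it satisfies every degree bound.\<close>
definition total_deg :: "'n::finite mpoly \<Rightarrow> nat" where
  "total_deg f = Max (insert 0 ((\<lambda>m. \<Sum>i\<in>UNIV. Poly_Mapping.lookup m i) ` Poly_Mapping.keys f))"

definition poly_ideal :: "'n::finite mpoly set \<Rightarrow> bool" where
  "poly_ideal I \<longleftrightarrow> 0 \<in> I \<and> (\<forall>f\<in>I. \<forall>g\<in>I. f + g \<in> I) \<and> (\<forall>f. \<forall>g\<in>I. f * g \<in> I)"

definition real_variety :: "'n::finite mpoly set \<Rightarrow> (real^'n) set" where
  "real_variety I = {x. \<forall>g\<in>I. eval_mpoly g x = 0}"

definition vanishing_ideal :: "(real^'n) set \<Rightarrow> 'n::finite mpoly set" where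
  "vanishing_ideal V = {g. \<forall>x\<in>V. eval_mpoly g x = 0}"

definition sum_of_squares :: "'n::finite mpoly \<Rightarrow> bool" where
  "sum_of_squares s \<longleftrightarrow> (\<exists>qs. s = (\<Sum>q\<leftarrow>qs. q ^ 2))"

definition Sigma_trunc :: "nat \<Rightarrow> 'n::finite mpoly set \<Rightarrow> 'n mpoly set" where
  "Sigma_trunc d I = {p. \<exists>s. sum_of_squares s \<and> total_deg s \<le> 2 * d \<and> p - s \<in> I}"

definition theta_body :: "'n::finite mpoly set \<Rightarrow> nat \<Rightarrow> (real^'n) set" where
  "theta_body I d = (\<Inter>l\<in>{l \<in> Sigma_trunc d I. total_deg l \<le> 1}. {x. eval_mpoly l x \<ge> 0})"

definition gradients_at :: "'n::finite mpoly set \<Rightarrow> real^'n \<Rightarrow> (real^'n) set" where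
  "gradients_at J p = {D. \<exists>g\<in>J. GDERIV (eval_mpoly g) p :> D}"

definition tangent_space :: "'n::finite mpoly set \<Rightarrow> real^'n \<Rightarrow> (real^'n) set" where
  "tangent_space I p =
     {p + w | w. \<forall>v\<in>span (gradients_at (vanishing_ideal (real_variety I)) p). orthogonal v w}"

text \<open>
  The boundary of the convex hull is its boundary inside its affine hull, in accordance with the
  relative interior used for tangency. (With the topological boundary in the whole space, every
  point of a variety with lower-dimensional convex hull would be a boundary point, and for instance
  all points of a line in the plane would be convex-singular.) For a full-dimensional convex hull
  the two notions agree.
\<close>
definition hull_boundary_point :: "'n::finite mpoly set \<Rightarrow> real^'n \<Rightarrow> bool" where
  "hull_boundary_point I p \<longleftrightarrow>
     p \<in> real_variety I \<and> p \<in> rel_frontier (convex hull real_variety I)"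

definition convex_nonsingular :: "'n::finite mpoly set \<Rightarrow> real^'n \<Rightarrow> bool" where
  "convex_nonsingular I p \<longleftrightarrow>
     hull_boundary_point I p \<and>
     tangent_space I p \<inter> rel_interior (convex hull real_variety I) = {}"

definition convex_singular :: "'n::finite mpoly set \<Rightarrow> real^'n \<Rightarrow> bool" where
  "convex_singular I p \<longleftrightarrow> hull_boundary_point I p \<and> \<not> convex_nonsingular I p"

end

theory Submission
  imports Defs "HOL-Computational_Algebra.Polynomial"
begin

text \<open>
  Let \<open>p\<close> be convex-singular and \<open>w\<close> a tangent direction with \<open>p + w\<close> in the relative interior of
  the convex hull. A hyperplane supporting the hull at \<open>p\<close> separates \<open>p - \<epsilon> w\<close> from it for every
  \<open>\<epsilon> > 0\<close>; it remains to put a nearby point into the theta body. On polynomials \<open>q\<close> of degree at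
  most \<open>d\<close>, the derivative at \<open>p\<close> along \<open>w\<close> vanishes whenever \<open>q\<close> vanishes on the variety, so by
  finite dimensionality it is a combination of evaluations, \<open>D q = (\<Sum>x\<in>S. c x * q x)\<close>, with a
  finite subset \<open>S\<close> of the variety. Put \<open>K = (\<Sum>x\<in>S. (c x)\<^sup>2)\<close>. The functional
  \<open>L f = f p - \<epsilon> * D f + K * \<epsilon>\<^sup>2 * (\<Sum>x\<in>S. f x)\<close> vanishes on the ideal, and by Cauchy-Schwarz
  \<open>L (q\<^sup>2) \<ge> (q p - \<epsilon> * D q)\<^sup>2 \<ge> 0\<close>. After normalisation, \<open>L\<close> acts on affine polynomials as
  evaluation at a point of the theta body, which is \<open>p - \<epsilon> w\<close> up to an error of order \<open>\<epsilon>\<^sup>2\<close>.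
\<close>

definition monomial_at :: "('n::finite \<Rightarrow>\<^sub>0 nat) \<Rightarrow> real^'n \<Rightarrow> real" where
  "monomial_at m x = (\<Prod>i\<in>UNIV. (x $ i) ^ Poly_Mapping.lookup m i)"

definition monomial_deg :: "('n::finite \<Rightarrow>\<^sub>0 nat) \<Rightarrow> nat" where
  "monomial_deg m = (\<Sum>i\<in>UNIV. Poly_Mapping.lookup m i)"

subsection \<open>Evaluation and degree\<close>

text \<open>Lets polynomials with different supports be compared over one common index set.\<close>

lemma eval_mpoly_superset:
  assumes "finite A" "Poly_Mapping.keys f \<subseteq> A"
  shows "eval_mpoly f x = (\<Sum>m\<in>A. Poly_Mapping.lookup f m * monomial_at m x)"
  unfolding eval_mpoly_def monomial_at_def
  using assms by (intro sum.mono_neutral_left) (auto simp: in_keys_iff)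

lemma eval_mpoly_keys:
  "eval_mpoly f x = (\<Sum>m\<in>Poly_Mapping.keys f. Poly_Mapping.lookup f m * monomial_at m x)"
  by (simp add: eval_mpoly_superset)

lemma eval_mpoly_0 [simp]: "eval_mpoly 0 x = 0"
  by (simp add: eval_mpoly_def)

lemma eval_mpoly_add: "eval_mpoly (f + g) x = eval_mpoly f x + eval_mpoly g x"
proof -
  let ?A = "Poly_Mapping.keys f \<union> Poly_Mapping.keys g"
  have "eval_mpoly h x = (\<Sum>m\<in>?A. Poly_Mapping.lookup h m * monomial_at m x)"
    if "Poly_Mapping.keys h \<subseteq> ?A" for h
    using that by (intro eval_mpoly_superset) auto
  then show ?thesis
    using Poly_Mapping.keys_add[of f g]
    by (simp add: lookup_add distrib_right sum.distrib)
qed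

lemma eval_mpoly_sum: "eval_mpoly (\<Sum>i\<in>A. f i) x = (\<Sum>i\<in>A. eval_mpoly (f i) x)"
  by (induction A rule: infinite_finite_induct) (auto simp: eval_mpoly_add)

lemma eval_mpoly_single: "eval_mpoly (Poly_Mapping.single m a) x = a * monomial_at m x"
  by (subst eval_mpoly_superset[of "{m}"]) auto

lemma sum_single_lookup:
  fixes f :: "'a \<Rightarrow>\<^sub>0 'b::comm_monoid_add"
  shows "(\<Sum>m\<in>Poly_Mapping.keys f. Poly_Mapping.single m (Poly_Mapping.lookup f m)) = f"
  by (rule poly_mapping_eqI)
     (auto simp: lookup_sum lookup_single when_def sum.delta' in_keys_iff)

lemma monomial_at_add: "monomial_at (m + k) x = monomial_at m x * monomial_at k x"
  by (simp add: monomial_at_def lookup_add power_add prod.distrib)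

lemma eval_mpoly_mult: "eval_mpoly (f * g) x = eval_mpoly f x * eval_mpoly g x"
proof -
  let ?t = "\<lambda>f m. Poly_Mapping.single m (Poly_Mapping.lookup f m)"
  have "f * g = (\<Sum>m\<in>Poly_Mapping.keys f. ?t f m) * (\<Sum>k\<in>Poly_Mapping.keys g. ?t g k)"
    by (simp add: sum_single_lookup)
  also have "\<dots> = (\<Sum>m\<in>Poly_Mapping.keys f. \<Sum>k\<in>Poly_Mapping.keys g. ?t f m * ?t g k)"
    by (simp add: sum_product)
  finally have "eval_mpoly (f * g) x =
      (\<Sum>m\<in>Poly_Mapping.keys f. \<Sum>k\<in>Poly_Mapping.keys g.
        Poly_Mapping.lookup f m * monomial_at m x * (Poly_Mapping.lookup g k * monomial_at k x))"
    by (simp add: eval_mpoly_sum mult_single eval_mpoly_single monomial_at_add mult_ac)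
  then show ?thesis
    by (simp add: eval_mpoly_keys[of f] eval_mpoly_keys[of g] sum_product)
qed

lemma eval_mpoly_sum_squares:
  "eval_mpoly (\<Sum>q\<leftarrow>qs. q ^ 2) x = (\<Sum>q\<leftarrow>qs. (eval_mpoly q x)\<^sup>2)"
  by (induction qs) (auto simp: eval_mpoly_add power2_eq_square eval_mpoly_mult)

lemma monomial_deg_le_total_deg:
  "m \<in> Poly_Mapping.keys f \<Longrightarrow> monomial_deg m \<le> total_deg f"
  unfolding total_deg_def monomial_deg_def by (intro Max_ge) auto

text \<open>Source of the finite dimensionality: every exponent is at most \<open>d\<close>, so
  exponent vectors inject into a finite function space.\<close>

lemma finite_monomials_deg_le: "finite {m :: 'n::finite \<Rightarrow>\<^sub>0 nat. monomial_deg m \<le> d}"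
proof (rule finite_imageD)
  have "Poly_Mapping.lookup m i \<le> monomial_deg m" for m :: "'n \<Rightarrow>\<^sub>0 nat" and i
    unfolding monomial_deg_def by (intro member_le_sum) auto
  then have "Poly_Mapping.lookup ` {m :: 'n \<Rightarrow>\<^sub>0 nat. monomial_deg m \<le> d} \<subseteq> UNIV \<rightarrow>\<^sub>E {..d}"
    by (auto intro: order_trans)
  then show "finite (Poly_Mapping.lookup ` {m :: 'n \<Rightarrow>\<^sub>0 nat. monomial_deg m \<le> d})"
    by (rule finite_subset) (intro finite_PiE; simp)
  show "inj_on Poly_Mapping.lookup {m :: 'n \<Rightarrow>\<^sub>0 nat. monomial_deg m \<le> d}"
    by (simp add: inj_on_def)
qed

lemma eval_mpoly_affine:
  assumes "total_deg f \<le> 1"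
  obtains a b where "\<And>x. eval_mpoly f x = a + b \<bullet> x"
proof -
  \<comment> \<open>A monomial of degree at most 1 is the constant 1 or a single coordinate.\<close>
  have mono: "\<exists>a b. \<forall>x. monomial_at m x = a + b \<bullet> x" if "monomial_deg m \<le> 1"
    for m :: "'n::finite \<Rightarrow>\<^sub>0 nat"
  proof (cases "\<exists>i. Poly_Mapping.lookup m i \<noteq> 0")
    case False
    then have "monomial_at m x = 1 + 0 \<bullet> x" for x
      by (simp add: monomial_at_def)
    then show ?thesis by blast
  next
    case True
    then obtain i where i: "Poly_Mapping.lookup m i \<noteq> 0" by blast
    have deg: "monomial_deg m = Poly_Mapping.lookup m i + (\<Sum>j\<in>UNIV - {i}. Poly_Mapping.lookup m j)"
      unfolding monomial_deg_def by (simp add: sum.remove)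
    then have "Poly_Mapping.lookup m i = 1" "(\<Sum>j\<in>UNIV - {i}. Poly_Mapping.lookup m j) = 0"
      using i that by linarith+
    then have "monomial_at m x = x $ i" for x
      unfolding monomial_at_def by (subst prod.remove[of _ i]) auto
    then have "monomial_at m x = 0 + axis i 1 \<bullet> x" for x
      by (simp add: inner_axis inner_commute)
    then show ?thesis by blast
  qed
  have "\<exists>a b. \<forall>x. monomial_at m x = a + b \<bullet> x" if "m \<in> Poly_Mapping.keys f" for m
    by (rule mono, rule order_trans[OF monomial_deg_le_total_deg[OF that] assms])
  then obtain a b where "\<And>m x. m \<in> Poly_Mapping.keys f \<Longrightarrow> monomial_at m x = a m + b m \<bullet> x"
    by metis
  then have "eval_mpoly f x =
      (\<Sum>m\<in>Poly_Mapping.keys f. Poly_Mapping.lookup f m * a m) +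
      (\<Sum>m\<in>Poly_Mapping.keys f. Poly_Mapping.lookup f m *\<^sub>R b m) \<bullet> x" for x
    by (simp add: eval_mpoly_keys distrib_left sum.distrib inner_sum_left)
  then show ?thesis by (rule that)
qed

section \<open>Univariate sums of squares and restriction to rays\<close>

text \<open>Let \<open>N\<close> be the largest degree among the \<open>ps\<close>. If
  \<open>N > d\<close>, the coefficient of degree \<open>2 * N\<close> of the sum vanishes by the
  degree bound, yet it is the sum of the squares of the degree \<open>N\<close> coefficients, at
  least one of which is nonzero.\<close>

lemma degree_of_sum_squares_le:
  fixes ps :: "real poly list"
  assumes "degree (\<Sum>p\<leftarrow>ps. p\<^sup>2) \<le> 2 * d" "p \<in> set ps"
  shows "degree p \<le> d"
proof (rule ccontr)
  assume "\<not> degree p \<le> d"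
  define N where "N = Max (degree ` set ps)"
  have le: "degree q \<le> N" if "q \<in> set ps" for q
    using that unfolding N_def by auto
  have "N \<in> degree ` set ps"
    unfolding N_def using assms(2) by (intro Max_in) auto
  then obtain r where r: "r \<in> set ps" "degree r = N" by auto
  have "N > d" using le[OF assms(2)] \<open>\<not> degree p \<le> d\<close> by simp
  have sq: "coeff (q\<^sup>2) (2 * N) = (coeff q N)\<^sup>2" if "degree q \<le> N" for q :: "real poly"
  proof (cases "degree q = N")
    case True
    then show ?thesis
      using coeff_mult_degree_sum[of q q] by (simp add: power2_eq_square mult_2)
  next
    case False
    then have "degree q < N" using that by simp
    moreover have "degree (q\<^sup>2) \<le> 2 * degree q"
      using degree_power_le[of q 2] by (simp add: mult.commute)
    ultimately show ?thesis by (simp add: coeff_eq_0)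
  qed
  have "coeff (\<Sum>q\<leftarrow>qs. q\<^sup>2) (2 * N) = (\<Sum>q\<leftarrow>qs. (coeff q N)\<^sup>2)"
    if "set qs \<subseteq> set ps" for qs
    using that by (induction qs) (auto simp: sq le)
  from this[of ps] have "(\<Sum>q\<leftarrow>ps. (coeff q N)\<^sup>2) = 0"
    using assms(1) \<open>N > d\<close> by (simp add: coeff_eq_0)
  moreover have "(coeff r N)\<^sup>2 \<le> (\<Sum>q\<leftarrow>ps. (coeff q N)\<^sup>2)"
    using r(1) by (intro member_le_sum_list) auto
  ultimately have "coeff r N = 0" by simp
  then have "r = 0" using r(2) by auto
  then show False using r(2) \<open>N > d\<close> by simp
qed

text \<open>The restriction of \<open>f\<close> to the line through the origin and \<open>x\<close>.
  Its coefficient of degree \<open>k\<close> is the homogeneous part of \<open>f\<close> of degree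
  \<open>k\<close>, evaluated at \<open>x\<close>.\<close>

definition ray_poly :: "'n::finite mpoly \<Rightarrow> real^'n \<Rightarrow> real poly" where
  "ray_poly f x =
     (\<Sum>m\<in>Poly_Mapping.keys f. monom (Poly_Mapping.lookup f m * monomial_at m x) (monomial_deg m))"

lemma monomial_at_scaleR: "monomial_at m (t *\<^sub>R x) = t ^ monomial_deg m * monomial_at m x"
  by (simp add: monomial_at_def monomial_deg_def power_mult_distrib prod.distrib power_sum)

lemma poly_ray_poly: "poly (ray_poly f x) t = eval_mpoly f (t *\<^sub>R x)"
  by (simp add: ray_poly_def poly_sum poly_monom eval_mpoly_keys monomial_at_scaleR mult_ac)

lemma degree_ray_poly: "degree (ray_poly f x) \<le> total_deg f"
  unfolding ray_poly_def
  by (intro degree_sum_le order_trans[OF degree_monom_le monomial_deg_le_total_deg]) auto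

lemma coeff_ray_poly:
  "coeff (ray_poly f x) k =
     (\<Sum>m | m \<in> Poly_Mapping.keys f \<and> monomial_deg m = k. Poly_Mapping.lookup f m * monomial_at m x)"
  by (simp add: ray_poly_def coeff_sum sum.inter_filter)

text \<open>
  Leading forms of squares cannot cancel. Restricting to rays reduces this to univariate
  polynomials and only yields an identity of functions, which is all that is needed.
\<close>
lemma eval_mpoly_sum_squares_truncate:
  fixes qs :: "'n::finite mpoly list"
  assumes "total_deg (\<Sum>q\<leftarrow>qs. q ^ 2) \<le> 2 * d" "q \<in> set qs"
  shows "eval_mpoly q x =
    (\<Sum>m | monomial_deg m \<le> d. Poly_Mapping.lookup q m * monomial_at m x)"
proof -
  let ?K = "Poly_Mapping.keys q"
  have "poly (ray_poly (\<Sum>q\<leftarrow>qs. q ^ 2) x) t = poly (\<Sum>p\<leftarrow>map (\<lambda>q. ray_poly q x) qs. p\<^sup>2) t" for t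
    by (induction qs) (auto simp: poly_ray_poly eval_mpoly_add power2_eq_square eval_mpoly_mult)
  then have "ray_poly (\<Sum>q\<leftarrow>qs. q ^ 2) x = (\<Sum>p\<leftarrow>map (\<lambda>q. ray_poly q x) qs. p\<^sup>2)"
    by (auto simp flip: poly_eq_poly_eq_iff)
  then have "degree (\<Sum>p\<leftarrow>map (\<lambda>q. ray_poly q x) qs. p\<^sup>2) \<le> 2 * d"
    using degree_ray_poly[of "\<Sum>q\<leftarrow>qs. q ^ 2" x] assms(1) by simp
  then have deg: "degree (ray_poly q x) \<le> d"
    by (rule degree_of_sum_squares_le) (use assms(2) in auto)
  \<comment> \<open>At parameter 1 the ray passes through \<open>x\<close>, and the bound
    \<open>deg\<close> cuts off all homogeneous parts of degree above \<open>d\<close>.\<close>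
  have "eval_mpoly q x = poly (ray_poly q x) 1"
    by (simp add: poly_ray_poly)
  also have "\<dots> = (\<Sum>k\<le>d. coeff (ray_poly q x) k)"
    by (subst poly_as_sum_of_monoms'[OF deg, symmetric]) (simp add: poly_sum poly_monom)
  also have "\<dots> = (\<Sum>k\<le>d. \<Sum>m | m \<in> {m \<in> ?K. monomial_deg m \<le> d} \<and> monomial_deg m = k.
      Poly_Mapping.lookup q m * monomial_at m x)"
    unfolding coeff_ray_poly by (intro sum.cong) auto
  also have "\<dots> = (\<Sum>m | m \<in> ?K \<and> monomial_deg m \<le> d. Poly_Mapping.lookup q m * monomial_at m x)"
    by (rule sum.group) auto
  also have "\<dots> = (\<Sum>m | monomial_deg m \<le> d. Poly_Mapping.lookup q m * monomial_at m x)"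
    by (intro sum.mono_neutral_left finite_monomials_deg_le) (auto simp: in_keys_iff)
  finally show ?thesis .
qed

subsection \<open>Directional derivatives\<close>

lemma has_derivative_frechet_derivative:
  "f differentiable at x \<Longrightarrow> (f has_derivative frechet_derivative f (at x)) (at x)"
  by (simp add: frechet_derivative_works)

lemma monomial_at_differentiable: "monomial_at m differentiable at p"
proof -
  have "((\<lambda>x. x $ i) has_derivative (\<lambda>h. h $ i)) (at p)" for i
    by (intro bounded_linear_imp_has_derivative bounded_linear_vec_nth)
  then have "\<exists>D. ((\<lambda>x. \<Prod>i\<in>UNIV. (x $ i) ^ Poly_Mapping.lookup m i) has_derivative D) (at p)"
    by (intro exI) (rule has_derivative_prod, rule has_derivative_power)
  then show ?thesis
    by (simp add: differentiable_def monomial_at_def[abs_def])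
qed

text \<open>The assumption is only an identity of functions and \<open>A\<close> need not contain
  the support of \<open>f\<close>, so the lemma also covers the truncated expansion of a summand
  \<open>q\<close>.\<close>

lemma frechet_derivative_monomial_sum:
  assumes "\<And>x. eval_mpoly f x = (\<Sum>m\<in>A. Poly_Mapping.lookup f m * monomial_at m x)"
  shows "eval_mpoly f differentiable at p"
    and "frechet_derivative (eval_mpoly f) (at p) w =
      (\<Sum>m\<in>A. Poly_Mapping.lookup f m * frechet_derivative (monomial_at m) (at p) w)"
proof -
  have *: "((\<lambda>x. \<Sum>m\<in>A. Poly_Mapping.lookup f m * monomial_at m x) has_derivative
      (\<lambda>h. \<Sum>m\<in>A. Poly_Mapping.lookup f m * frechet_derivative (monomial_at m) (at p) h)) (at p)"
    by (intro has_derivative_sum has_derivative_mult_right has_derivative_frechet_derivative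
        monomial_at_differentiable)
  have **: "eval_mpoly f = (\<lambda>x. \<Sum>m\<in>A. Poly_Mapping.lookup f m * monomial_at m x)"
    using assms by auto
  show "eval_mpoly f differentiable at p"
    using * unfolding ** differentiable_def by blast
  show "frechet_derivative (eval_mpoly f) (at p) w =
      (\<Sum>m\<in>A. Poly_Mapping.lookup f m * frechet_derivative (monomial_at m) (at p) w)"
    using fun_cong[OF frechet_derivative_at[OF *], of w] unfolding ** by simp
qed

lemmas eval_mpoly_differentiable = frechet_derivative_monomial_sum(1)[OF eval_mpoly_keys]

lemma frechet_derivative_eval_mpoly_add:
  "frechet_derivative (eval_mpoly (f + g)) (at p) w =
     frechet_derivative (eval_mpoly f) (at p) w + frechet_derivative (eval_mpoly g) (at p) w"
proof -
  have "((\<lambda>x. eval_mpoly f x + eval_mpoly g x) has_derivative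
      (\<lambda>h. frechet_derivative (eval_mpoly f) (at p) h + frechet_derivative (eval_mpoly g) (at p) h))
      (at p)"
    by (intro has_derivative_add has_derivative_frechet_derivative eval_mpoly_differentiable)
  moreover have "eval_mpoly (f + g) = (\<lambda>x. eval_mpoly f x + eval_mpoly g x)"
    by (auto simp: eval_mpoly_add)
  ultimately show ?thesis
    using fun_cong[OF frechet_derivative_at, of "eval_mpoly (f + g)" _ p w] by simp
qed

lemma frechet_derivative_eval_mpoly_square:
  "frechet_derivative (eval_mpoly (q ^ 2)) (at p) w =
     2 * eval_mpoly q p * frechet_derivative (eval_mpoly q) (at p) w"
proof -
  have "((\<lambda>x. (eval_mpoly q x)\<^sup>2) has_derivative
      (\<lambda>h. of_nat 2 * frechet_derivative (eval_mpoly q) (at p) h * eval_mpoly q p ^ (2 - 1))) (at p)"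
    by (intro has_derivative_power has_derivative_frechet_derivative eval_mpoly_differentiable)
  moreover have "eval_mpoly (q ^ 2) = (\<lambda>x. (eval_mpoly q x)\<^sup>2)"
    by (auto simp: power2_eq_square eval_mpoly_mult)
  ultimately show ?thesis
    using fun_cong[OF frechet_derivative_at, of "eval_mpoly (q ^ 2)" _ p w] by (simp add: mult_ac)
qed

lemma frechet_derivative_eval_mpoly_sum_squares:
  "frechet_derivative (eval_mpoly (\<Sum>q\<leftarrow>qs. q ^ 2)) (at p) w =
     (\<Sum>q\<leftarrow>qs. 2 * eval_mpoly q p * frechet_derivative (eval_mpoly q) (at p) w)"
proof (induction qs)
  case Nil
  have "eval_mpoly (0 :: 'a mpoly) = (\<lambda>x. 0)" by auto
  then show ?case by simp
next
  case (Cons q qs)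
  then show ?case
    by (simp add: frechet_derivative_eval_mpoly_add frechet_derivative_eval_mpoly_square)
qed

text \<open>The gradient of \<open>g\<close> at \<open>p\<close> is the vector representing its
  derivative, obtained as \<open>adjoint ?D 1\<close>. Tangent directions are orthogonal to it by
  definition.\<close>

lemma tangent_space_derivative_zero:
  assumes "y \<in> tangent_space I p" "g \<in> vanishing_ideal (real_variety I)"
  shows "frechet_derivative (eval_mpoly g) (at p) (y - p) = 0"
proof -
  let ?D = "frechet_derivative (eval_mpoly g) (at p)"
  have hd: "(eval_mpoly g has_derivative ?D) (at p)"
    by (intro has_derivative_frechet_derivative eval_mpoly_differentiable)
  then have "linear ?D" by (rule has_derivative_linear)
  then have D: "?D = (\<lambda>h. h \<bullet> adjoint ?D 1)"
    using adjoint_works[of ?D _ "1::real"] by auto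
  then have "GDERIV (eval_mpoly g) p :> adjoint ?D 1"
    using hd unfolding gderiv_def by simp
  then have "adjoint ?D 1 \<in> span (gradients_at (vanishing_ideal (real_variety I)) p)"
    using assms(2) by (auto simp: gradients_at_def intro: span_base)
  then have "orthogonal (adjoint ?D 1) (y - p)"
    using assms(1) by (auto simp: tangent_space_def)
  then show ?thesis
    by (subst D) (simp add: orthogonal_def inner_commute)
qed

subsection \<open>Derivatives as combinations of evaluations\<close>

text \<open>The bipolar theorem for a family of vectors \<open>e x\<close> in the space of functions on \<open>B\<close>.\<close>
lemma in_finite_span_if_annihilated:
  fixes e :: "'a \<Rightarrow> 'b \<Rightarrow> real"
  assumes "finite B"
    and "\<And>c. (\<forall>x\<in>V. (\<Sum>b\<in>B. c b * e x b) = 0) \<Longrightarrow> (\<Sum>b\<in>B. c b * f b) = 0"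
  shows "\<exists>S a. finite S \<and> S \<subseteq> V \<and> (\<forall>b\<in>B. f b = (\<Sum>x\<in>S. a x * e x b))"
  using assms
proof (induction B arbitrary: e f rule: finite_induct)
  case empty
  then show ?case by (intro exI[of _ "{}"]) auto
next
  case (insert b0 B)
  show ?case
  proof (cases "\<forall>x\<in>V. e x b0 = 0")
    case True
    have "(\<Sum>b\<in>B. c b * f b) = 0" if "\<forall>x\<in>V. (\<Sum>b\<in>B. c b * e x b) = 0" for c
    proof -
      \<comment> \<open>Every \<open>e x\<close> vanishes at \<open>b0\<close>, so the value of a
        test vector there is free; 0 also removes \<open>f b0\<close>.\<close>
      have upd: "(\<Sum>b\<in>B. (c(b0 := 0)) b * h b) = (\<Sum>b\<in>B. c b * h b)" for h
        using insert.hyps by (intro sum.cong) auto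
      show ?thesis
        using insert.prems[of "c(b0 := 0)"] that insert.hyps by (simp add: upd[simplified])
    qed
    from insert.IH[of e f, OF this] obtain S a where S: "finite S" "S \<subseteq> V"
      "\<forall>b\<in>B. f b = (\<Sum>x\<in>S. a x * e x b)" by blast
    have "f b0 = 0"
      using insert.prems[of "\<lambda>b. if b = b0 then 1 else 0"] True insert.hyps
      by (simp add: if_distrib[of "\<lambda>t. t * _"] sum.If_cases)
    moreover have "(\<Sum>x\<in>S. a x * e x b0) = 0"
      using True S(2) by (intro sum.neutral) auto
    ultimately show ?thesis using S by (intro exI[of _ S] exI[of _ a]) auto
  next
    case False
    then obtain x0 where x0: "x0 \<in> V" "e x0 b0 \<noteq> 0" by blast
    \<comment> \<open>Gaussian elimination: subtracting a multiple of the pivot \<open>e x0\<close>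
      clears the coordinate \<open>b0\<close>.\<close>
    define r where "r h b = h b - h b0 / e x0 b0 * e x0 b" for h b
    have "(\<Sum>b\<in>B. c b * r f b) = 0" if c: "\<forall>x\<in>V. (\<Sum>b\<in>B. c b * r (e x) b) = 0" for c
    proof -
      \<comment> \<open>The value at \<open>b0\<close> makes \<open>c'\<close> annihilate
        \<open>e x0\<close>, so pairing \<open>c'\<close> with \<open>h\<close> equals pairing
        \<open>c\<close> with the reduced vector \<open>r h\<close>.\<close>
      define c' where "c' = c(b0 := - (\<Sum>b\<in>B. c b * e x0 b) / e x0 b0)"
      have "(\<Sum>b\<in>insert b0 B. c' b * h b) = (\<Sum>b\<in>B. c b * r h b)" for h
      proof -
        have "(\<Sum>b\<in>B. c' b * h b) = (\<Sum>b\<in>B. c b * h b)"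
          unfolding c'_def using insert.hyps by (intro sum.cong) auto
        then show ?thesis
          using insert.hyps
          by (simp add: c'_def r_def right_diff_distrib sum_subtractf sum_distrib_left
              sum_distrib_right sum_divide_distrib mult_ac sum_negf)
      qed
      then show ?thesis using insert.prems[of c'] c by simp
    qed
    from insert.IH[of "\<lambda>x. r (e x)" "r f", OF this] obtain S a where S: "finite S" "S \<subseteq> V"
      and a: "\<forall>b\<in>B. r f b = (\<Sum>x\<in>S. a x * r (e x) b)" by blast
    have r0: "r h b0 = 0" for h using x0 by (simp add: r_def)
    have a': "r f b = (\<Sum>x\<in>S. a x * r (e x) b)" if "b \<in> insert b0 B" for b
      using that a by (auto simp: r0)
    \<comment> \<open>The total multiple of \<open>e x0\<close> left over when the reductions of
      \<open>f\<close> and of all \<open>e x\<close> are undone.\<close>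
    define k where "k = f b0 / e x0 b0 - (\<Sum>x\<in>S. a x * (e x b0 / e x0 b0))"
    \<comment> \<open>\<open>x0\<close> may already belong to \<open>S\<close>, so its two
      contributions are added.\<close>
    define a2 where "a2 x = (if x \<in> S then a x else 0) + (if x = x0 then k else 0)" for x
    have "f b = (\<Sum>x\<in>insert x0 S. a2 x * e x b)" if b: "b \<in> insert b0 B" for b
    proof -
      have "(\<Sum>x\<in>insert x0 S. a2 x * e x b) =
          (\<Sum>x\<in>insert x0 S. (if x \<in> S then a x * e x b else 0) + (if x = x0 then k * e x b else 0))"
        by (intro sum.cong) (auto simp: a2_def distrib_right)
      also have "\<dots> = (\<Sum>x\<in>insert x0 S. if x \<in> S then a x * e x b else 0) + k * e x0 b"
        using S(1) by (simp only: sum.distrib sum.delta finite_insert) simp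
      also have "(\<Sum>x\<in>insert x0 S. if x \<in> S then a x * e x b else 0) = (\<Sum>x\<in>S. a x * e x b)"
        using S(1) by (intro sum.mono_neutral_cong_right) auto
      also have "(\<Sum>x\<in>S. a x * e x b) + k * e x0 b = f b"
        using a'[OF b]
        by (simp add: r_def k_def right_diff_distrib left_diff_distrib sum_subtractf
            sum_distrib_left sum_distrib_right mult_ac)
      finally show ?thesis by simp
    qed
    then show ?thesis
      using S x0 by (intro exI[of _ "insert x0 S"] exI[of _ a2]) auto
  qed
qed

text \<open>\<open>S\<close> and \<open>c\<close> are chosen before \<open>qs\<close>, so one point
  can later serve for all \<open>l\<close> at once. Coefficients on the monomials of degree at most
  \<open>d\<close> that annihilate all evaluations form a polynomial in the vanishing ideal, and its
  tangential derivative is zero.\<close>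

lemma tangent_derivative_as_evaluations:
  fixes I :: "'n::finite mpoly set"
  assumes "y \<in> tangent_space I p"
  shows "\<exists>S c. finite S \<and> S \<subseteq> real_variety I \<and>
    (\<forall>qs. total_deg (\<Sum>q\<leftarrow>qs. q ^ 2) \<le> 2 * d \<longrightarrow> (\<forall>q\<in>set qs.
      frechet_derivative (eval_mpoly q) (at p) (y - p) = (\<Sum>x\<in>S. c x * eval_mpoly q x)))"
proof -
  let ?B = "{m :: 'n \<Rightarrow>\<^sub>0 nat. monomial_deg m \<le> d}"
  let ?D = "\<lambda>m. frechet_derivative (monomial_at m) (at p) (y - p)"
  have "(\<Sum>m\<in>?B. c m * ?D m) = 0"
    if c: "\<forall>x\<in>real_variety I. (\<Sum>m\<in>?B. c m * monomial_at m x) = 0" for c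
  proof -
    define g where "g = (\<Sum>m\<in>?B. Poly_Mapping.single m (c m))"
    have lk: "Poly_Mapping.lookup g m = c m" if "m \<in> ?B" for m
      using that unfolding g_def
      by (simp add: lookup_sum lookup_single when_def finite_monomials_deg_le)
    have ev: "eval_mpoly g x = (\<Sum>m\<in>?B. c m * monomial_at m x)" for x
      by (simp add: g_def eval_mpoly_sum eval_mpoly_single)
    also have "\<dots> x = (\<Sum>m\<in>?B. Poly_Mapping.lookup g m * monomial_at m x)" for x
      by (intro sum.cong) (auto simp: lk)
    finally have "frechet_derivative (eval_mpoly g) (at p) (y - p) =
        (\<Sum>m\<in>?B. Poly_Mapping.lookup g m * ?D m)"
      by (rule frechet_derivative_monomial_sum(2))
    moreover have "g \<in> vanishing_ideal (real_variety I)"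
      using c by (simp add: vanishing_ideal_def ev)
    ultimately have "(\<Sum>m\<in>?B. Poly_Mapping.lookup g m * ?D m) = 0"
      using tangent_space_derivative_zero[OF assms] by simp
    moreover have "(\<Sum>m\<in>?B. Poly_Mapping.lookup g m * ?D m) = (\<Sum>m\<in>?B. c m * ?D m)"
      by (intro sum.cong) (simp_all add: lk)
    ultimately show ?thesis by simp
  qed
  from in_finite_span_if_annihilated[of ?B "real_variety I" "\<lambda>x m. monomial_at m x" ?D,
      OF finite_monomials_deg_le this]
  obtain S c where S: "finite S" "S \<subseteq> real_variety I"
    and c: "\<forall>m\<in>?B. ?D m = (\<Sum>x\<in>S. c x * monomial_at m x)" by blast
  have "frechet_derivative (eval_mpoly q) (at p) (y - p) = (\<Sum>x\<in>S. c x * eval_mpoly q x)"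
    if "total_deg (\<Sum>q\<leftarrow>qs. q ^ 2) \<le> 2 * d" "q \<in> set qs" for qs q
  proof -
    note ev = eval_mpoly_sum_squares_truncate[OF that]
    have "frechet_derivative (eval_mpoly q) (at p) (y - p) =
        (\<Sum>m\<in>?B. Poly_Mapping.lookup q m * (\<Sum>x\<in>S. c x * monomial_at m x))"
      unfolding frechet_derivative_monomial_sum(2)[OF ev] using c by (intro sum.cong) auto
    also have "\<dots> = (\<Sum>x\<in>S. c x * eval_mpoly q x)"
      unfolding ev sum_distrib_left by (subst sum.swap) (simp add: mult_ac)
    finally show ?thesis .
  qed
  with S show ?thesis by blast
qed

subsection \<open>Theta bodies\<close>

text \<open>On the variety \<open>l\<close> agrees with a sum of squares, so each defining
  half-space contains the variety; being closed and convex, it contains the closed hull.\<close>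

lemma closure_hull_subset_theta_body:
  "closure (convex hull real_variety I) \<subseteq> theta_body I d"
  unfolding theta_body_def
proof (intro INT_greatest)
  fix l assume "l \<in> {l \<in> Sigma_trunc d I. total_deg l \<le> 1}"
  then obtain s where s: "sum_of_squares s" "l - s \<in> I" and "total_deg l \<le> 1"
    by (auto simp: Sigma_trunc_def)
  obtain a b where ab: "\<And>x. eval_mpoly l x = a + b \<bullet> x"
    using eval_mpoly_affine[OF \<open>total_deg l \<le> 1\<close>] by blast
  obtain qs where qs: "s = (\<Sum>q\<leftarrow>qs. q ^ 2)"
    using s(1) by (auto simp: sum_of_squares_def)
  have half: "{x. eval_mpoly l x \<ge> 0} = {x. b \<bullet> x \<ge> - a}"
    by (auto simp: ab)
  have "eval_mpoly l x \<ge> 0" if "x \<in> real_variety I" for x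
  proof -
    have "eval_mpoly l x = eval_mpoly s x"
      using eval_mpoly_add[of "l - s" s x] that s(2) by (simp add: real_variety_def)
    also have "\<dots> \<ge> 0"
      unfolding qs eval_mpoly_sum_squares by (intro sum_list_nonneg) auto
    finally show ?thesis .
  qed
  then have "real_variety I \<subseteq> {x. b \<bullet> x \<ge> - a}"
    using half by blast
  then show "closure (convex hull real_variety I) \<subseteq> {x. eval_mpoly l x \<ge> 0}"
    unfolding half
    by (intro closure_minimal hull_minimal convex_halfspace_ge closed_halfspace_ge)
qed

theorem theorem4p5:
  fixes I :: "'n::finite mpoly set"
  assumes "poly_ideal I"
    and "\<exists>p. convex_singular I p"
  shows "\<forall>d. closure (convex hull real_variety I) \<subset> theta_body I d"
proof
  fix d
  let ?C = "convex hull real_variety I"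
  obtain p y where p: "p \<in> real_variety I" "p \<in> rel_frontier ?C"
    and y: "y \<in> tangent_space I p" "y \<in> rel_interior ?C"
    using assms(2) unfolding convex_singular_def convex_nonsingular_def hull_boundary_point_def
    by blast
  define w where "w = y - p"
  have "p \<in> ?C" using p(1) by (rule hull_inc)
  moreover have "p \<notin> rel_interior ?C" using p(2) by (simp add: rel_frontier_def)
  \<comment> \<open>Strictness on the relative interior, which contains \<open>y\<close>, is what
    gives \<open>a \<bullet> w > 0\<close>.\<close>
  ultimately have "\<exists>a. (\<forall>z\<in>?C. a \<bullet> p \<le> a \<bullet> z) \<and> (\<forall>z\<in>rel_interior ?C. a \<bullet> p < a \<bullet> z)"
    by (rule supporting_hyperplane_rel_boundary[OF convex_convex_hull]) auto
  then obtain a where aC: "\<And>z. z \<in> ?C \<Longrightarrow> a \<bullet> p \<le> a \<bullet> z"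
    and ari: "\<And>z. z \<in> rel_interior ?C \<Longrightarrow> a \<bullet> p < a \<bullet> z"
    by blast
  have acl: "closure ?C \<subseteq> {z. a \<bullet> z \<ge> a \<bullet> p}"
    using aC by (intro closure_minimal closed_halfspace_ge) auto
  have aw: "a \<bullet> w > 0" using ari[OF y(2)] by (simp add: w_def inner_diff_right)
  obtain S c where S: "finite S" "S \<subseteq> real_variety I"
    and c: "\<forall>qs. total_deg (\<Sum>q\<leftarrow>qs. q ^ 2) \<le> 2 * d \<longrightarrow> (\<forall>q\<in>set qs.
      frechet_derivative (eval_mpoly q) (at p) w = (\<Sum>x\<in>S. c x * eval_mpoly q x))"
    using tangent_derivative_as_evaluations[OF y(1), of d, folded w_def]
    by (elim exE conjE) (rule that)
  define K where "K = (\<Sum>x\<in>S. (c x)\<^sup>2)"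
  \<comment> \<open>\<open>\<epsilon>\<^sup>2 * M\<close> is the second-order term of
    \<open>r * (a \<bullet> (z - p))\<close>; its first-order term is
    \<open>- \<epsilon> * (a \<bullet> w)\<close>.\<close>
  define M where "M = K * (\<Sum>x\<in>S. a \<bullet> (x - p))"
  have "K \<ge> 0" unfolding K_def by (intro sum_nonneg) auto
  \<comment> \<open>Small enough for the first-order term to dominate; the \<open>+ 1\<close> guards
    against \<open>M = 0\<close>.\<close>
  define \<epsilon> where "\<epsilon> = (a \<bullet> w) / (\<bar>M\<bar> + 1)"
  have "\<epsilon> > 0" using aw by (simp add: \<epsilon>_def)
  have "\<epsilon> * M < a \<bullet> w"
  proof -
    have "\<epsilon> * M \<le> \<epsilon> * \<bar>M\<bar>" using \<open>\<epsilon> > 0\<close> by (intro mult_left_mono) auto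
    also have "\<dots> < \<epsilon> * (\<bar>M\<bar> + 1)" using \<open>\<epsilon> > 0\<close> by simp
    also have "\<dots> = a \<bullet> w" by (simp add: \<epsilon>_def)
    finally show ?thesis .
  qed
  define \<delta> where "\<delta> = K * \<epsilon>\<^sup>2"
  have "\<delta> \<ge> 0" using \<open>K \<ge> 0\<close> by (simp add: \<delta>_def)
  \<comment> \<open>The value of the functional \<open>L\<close> at the constant 1, hence the
    normalising factor.\<close>
  define r where "r = 1 + \<delta> * real (card S)"
  have "r > 0" using \<open>\<delta> \<ge> 0\<close> unfolding r_def by (simp add: add_pos_nonneg)
  \<comment> \<open>The coordinates of \<open>z\<close> are the values of \<open>L / r\<close> at
    the coordinate functions.\<close>
  define z where "z = (1 / r) *\<^sub>R (p - \<epsilon> *\<^sub>R w + \<delta> *\<^sub>R (\<Sum>x\<in>S. x))"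
  have rz: "r * (b \<bullet> z) = b \<bullet> p - \<epsilon> * (b \<bullet> w) + \<delta> * (\<Sum>x\<in>S. b \<bullet> x)" for b
    using \<open>r > 0\<close> by (simp add: z_def inner_add_right inner_diff_right inner_sum_right)
  have "z \<notin> closure ?C"
  proof
    assume "z \<in> closure ?C"
    then have "r * (a \<bullet> p) \<le> r * (a \<bullet> z)" using acl \<open>r > 0\<close> by auto
    moreover have "r * (a \<bullet> z) - r * (a \<bullet> p) = \<epsilon> * (\<epsilon> * M - a \<bullet> w)"
      unfolding rz unfolding r_def M_def \<delta>_def
      by (simp add: inner_diff_right sum_subtractf algebra_simps power2_eq_square)
    moreover have "\<epsilon> * (\<epsilon> * M - a \<bullet> w) < 0"
      using \<open>\<epsilon> > 0\<close> \<open>\<epsilon> * M < a \<bullet> w\<close> by (simp add: mult_pos_neg)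
    ultimately show False by linarith
  qed
  moreover have "z \<in> theta_body I d"
    unfolding theta_body_def
  proof (intro INT_I CollectI)
    fix l assume "l \<in> {l \<in> Sigma_trunc d I. total_deg l \<le> 1}"
    then obtain s where s: "sum_of_squares s" "total_deg s \<le> 2 * d" "l - s \<in> I"
      and "total_deg l \<le> 1"
      by (auto simp: Sigma_trunc_def)
    obtain qs where qs: "s = (\<Sum>q\<leftarrow>qs. q ^ 2)"
      using s(1) by (auto simp: sum_of_squares_def)
    obtain a0 b where ab: "\<And>x. eval_mpoly l x = a0 + b \<bullet> x"
      using eval_mpoly_affine[OF \<open>total_deg l \<le> 1\<close>] by blast
    let ?D = "\<lambda>f. frechet_derivative (eval_mpoly f) (at p) w"
    have ls: "eval_mpoly l x = eval_mpoly s x" if "x \<in> real_variety I" for x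
      using eval_mpoly_add[of "l - s" s x] that s(3) by (simp add: real_variety_def)
    have "l - s \<in> vanishing_ideal (real_variety I)"
      using s(3) by (auto simp: vanishing_ideal_def real_variety_def)
    \<comment> \<open>The only use of tangency for \<open>l\<close> itself: modulo the ideal,
      \<open>l\<close> and \<open>s\<close> have the same derivative along \<open>w\<close>.\<close>
    then have "?D (l - s) = 0"
      unfolding w_def by (rule tangent_space_derivative_zero[OF y(1)])
    then have Dl: "?D l = ?D s"
      using frechet_derivative_eval_mpoly_add[of "l - s" s p w] by simp
    have "(eval_mpoly l has_derivative (\<lambda>h. b \<bullet> h)) (at p)"
      unfolding ab[abs_def] by (auto intro!: derivative_eq_intros)
    then have Db: "?D l = b \<bullet> w"
      by (metis frechet_derivative_at)
    have nonneg: "0 \<le> (eval_mpoly q p)\<^sup>2 - \<epsilon> * (2 * eval_mpoly q p * ?D q) +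
        \<delta> * (\<Sum>x\<in>S. (eval_mpoly q x)\<^sup>2)" if "q \<in> set qs" for q
    proof -
      have "?D q = (\<Sum>x\<in>S. c x * eval_mpoly q x)"
        using c s(2) that unfolding qs by blast
      then have "(?D q)\<^sup>2 \<le> K * (\<Sum>x\<in>S. (eval_mpoly q x)\<^sup>2)"
        unfolding K_def using Cauchy_Schwarz_ineq_sum[of c "eval_mpoly q" S] by simp
      then have "\<epsilon>\<^sup>2 * (?D q)\<^sup>2 \<le> \<epsilon>\<^sup>2 * (K * (\<Sum>x\<in>S. (eval_mpoly q x)\<^sup>2))"
        by (intro mult_left_mono) auto
      then have "\<epsilon>\<^sup>2 * (?D q)\<^sup>2 \<le> \<delta> * (\<Sum>x\<in>S. (eval_mpoly q x)\<^sup>2)"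
        by (simp add: \<delta>_def mult_ac)
      \<comment> \<open>Completing the square: the missing term
        \<open>\<epsilon>\<^sup>2 * (?D q)\<^sup>2\<close> is bounded by the \<open>\<delta>\<close>
        term.\<close>
      moreover have "0 \<le> (eval_mpoly q p - \<epsilon> * ?D q)\<^sup>2" by simp
      ultimately show ?thesis
        by (simp add: power2_eq_square algebra_simps)
    qed
    have "r * eval_mpoly l z = r * a0 + r * (b \<bullet> z)"
      by (simp add: ab distrib_left)
    also have "\<dots> = eval_mpoly l p - \<epsilon> * ?D l + \<delta> * (\<Sum>x\<in>S. eval_mpoly l x)"
      unfolding rz Db by (simp add: ab r_def sum.distrib algebra_simps)
    \<comment> \<open>\<open>L\<close> does not distinguish \<open>l\<close> from \<open>s\<close>,
      since \<open>p\<close> and all points of \<open>S\<close> lie on the variety and the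
      derivatives agree.\<close>
    also have "\<dots> = eval_mpoly s p - \<epsilon> * ?D s + \<delta> * (\<Sum>x\<in>S. eval_mpoly s x)"
      using S(2) p(1) by (simp add: ls Dl subset_iff cong: sum.cong)
    also have "\<dots> = (\<Sum>q\<leftarrow>qs. (eval_mpoly q p)\<^sup>2 - \<epsilon> * (2 * eval_mpoly q p * ?D q) +
        \<delta> * (\<Sum>x\<in>S. (eval_mpoly q x)\<^sup>2))"
      unfolding qs frechet_derivative_eval_mpoly_sum_squares eval_mpoly_sum_squares
      by (induction qs) (simp_all add: sum.distrib algebra_simps)
    also have "\<dots> \<ge> 0"
      by (intro sum_list_nonneg) (use nonneg in auto)
    finally show "eval_mpoly l z \<ge> 0"
      using \<open>r > 0\<close> by (simp add: zero_le_mult_iff)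
  qed
  ultimately show "closure ?C \<subset> theta_body I d"
    using closure_hull_subset_theta_body by blast
qed

end
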